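(* Let $B(x,y)\in\mathbb{Z}[x][[y]]$ be the unique formal power series satisfying $B=1+xyB^2\bigl(xB^2-(x-1)(B-1)\bigr)$, and let $b_n^{(m)}:=[x^ny^m]B(x,y)$ for nonnegative integers $n,m$. For all positive integers $n$ and $m$, the number of $(102,000)$-avoiding inversion sequences $e$ of length $n$ with $\operatorname{dist}(e)=m$ equals $$b_{n+1}^{(m)}+\sum_{k=1}^{n}\sum_{\ell=0}^{m}b_k^{(\ell)}\,b_{n-k}^{(m-\ell)}.$$
   Context: An inversion sequence of length $n$ is an integer sequence $e=(e_1,\dots,e_n)$ with $0\le e_j\le j-1$ for all $j$. It is $(102,000)$-avoiding if there are no indices $i<j<k$ with $e_j<e_i<e_k$ (pattern $102$) and no indices $i<j<k$ with $e_i=e_j=e_k$ (pattern $000$). $\operatorname{dist}(e)$ is the number of distinct entries of $e$. $[x^ny^m]F$ denotes the coefficient of $x^ny^m$ in $F$. *)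

theory Defs
  imports "HOL-Computational_Algebra.Computational_Algebra"
begin

(* The entry e_j (1 \<le> j \<le> n) is the list element e ! (j - 1), so 0 \<le> e_j \<le> j - 1 reads e ! i \<le> i. *)
definition inversion_seqs :: "nat \<Rightarrow> nat list set" where
  "inversion_seqs n = {e. length e = n \<and> (\<forall>i<n. e ! i \<le> i)}"

definition avoids_102 :: "nat list \<Rightarrow> bool" where
  "avoids_102 e \<longleftrightarrow>
     \<not> (\<exists>i j k. i < j \<and> j < k \<and> k < length e \<and> e ! j < e ! i \<and> e ! i < e ! k)"

definition avoids_000 :: "nat list \<Rightarrow> bool" where
  "avoids_000 e \<longleftrightarrow>
     \<not> (\<exists>i j k. i < j \<and> j < k \<and> k < length e \<and> e ! i = e ! j \<and> e ! j = e ! k)"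

definition num_distinct :: "nat list \<Rightarrow> nat" where
  "num_distinct e = card (set e)"

(* The ring Z[x][[y]] is rendered as int poly fps: x is the polynomial variable, embedded as a
   constant series, and y is fps_X. *)
definition ser_x :: "int poly fps" where
  "ser_x = fps_const [:0, 1:]"

definition ser_y :: "int poly fps" where
  "ser_y = fps_X"

definition B_equation :: "int poly fps \<Rightarrow> bool" where
  "B_equation B \<longleftrightarrow>
     B = 1 + ser_x * ser_y * B^2 * (ser_x * B^2 - (ser_x - 1) * (B - 1))"

(* Well defined by B_equation_unique below. *)
definition B_ser :: "int poly fps" where
  "B_ser = (THE B. B_equation B)"

(* b_coeff n m is the coefficient of x^n y^m. *)
definition b_coeff :: "nat \<Rightarrow> nat \<Rightarrow> int" where
  "b_coeff n m = coeff (fps_nth B_ser m) n"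

definition agree :: "nat \<Rightarrow> 'a fps \<Rightarrow> 'a fps \<Rightarrow> bool" where
  "agree n A C \<longleftrightarrow> (\<forall>k<n. fps_nth A k = fps_nth C k)"

lemma agree_refl: "agree n A A"
  by (simp add: agree_def)

lemma agree_add: "agree n A C \<Longrightarrow> agree n A' C' \<Longrightarrow> agree n (A + A') (C + C')"
  for A C :: "'a::comm_ring_1 fps"
  by (simp add: agree_def)

lemma agree_diff: "agree n A C \<Longrightarrow> agree n A' C' \<Longrightarrow> agree n (A - A') (C - C')"
  for A C :: "'a::comm_ring_1 fps"
  by (simp add: agree_def)

lemma agree_mult: "agree n A C \<Longrightarrow> agree n A' C' \<Longrightarrow> agree n (A * A') (C * C')"
  for A C :: "'a::comm_ring_1 fps"
  by (auto simp: agree_def fps_mult_nth intro!: sum.cong)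

lemma agree_power: "agree n A C \<Longrightarrow> agree n (A ^ k) (C ^ k)"
  for A C :: "'a::comm_ring_1 fps"
  by (induction k) (auto intro: agree_mult agree_refl)

lemma agree_X: "agree n A C \<Longrightarrow> agree (Suc n) (fps_X * A) (fps_X * C)"
  for A C :: "'a::comm_ring_1 fps"
  by (auto simp: agree_def)

lemma agree_eq: "(\<And>n. agree n A C) \<Longrightarrow> A = C"
  by (metis agree_def fps_ext lessI)

lemma contraction_unique_fixpoint:
  fixes F :: "'a::comm_ring_1 fps \<Rightarrow> 'a fps"
  assumes F: "\<And>n A C. agree n A C \<Longrightarrow> agree (Suc n) (F A) (F C)"
  shows "\<exists>!A. A = F A"
proof -
  define s where "s j = (F ^^ j) 0" for j
  have s_Suc: "s (Suc j) = F (s j)" for j by (simp add: s_def)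
  have step: "agree j (s j) (s (j + d))" for j d
  proof (induction j)
    case 0
    then show ?case by (simp add: agree_def)
  next
    case (Suc j)
    then show ?case using F by (simp add: s_Suc)
  qed
  define L where "L = Abs_fps (\<lambda>n. fps_nth (s (Suc n)) n)"
  have L: "agree j L (s j)" for j
    unfolding agree_def
  proof (intro allI impI)
    fix k assume "k < j"
    then have "Suc k + (j - Suc k) = j" by simp
    with step[of "Suc k" "j - Suc k"] show "fps_nth L k = fps_nth (s j) k"
      by (simp add: agree_def L_def)
  qed
  have "agree n L (F L)" for n
    using F[OF L[of n]] L[of "Suc n"] by (simp add: agree_def s_Suc)
  then have ex: "L = F L" by (rule agree_eq)
  have "A = C" if "A = F A" "C = F C" for A C
  proof (rule agree_eq)
    show "agree n A C" for n
    proof (induction n)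
      case 0
      then show ?case by (simp add: agree_def)
    next
      case (Suc n)
      then show ?case using F that by metis
    qed
  qed
  with ex show ?thesis by blast
qed

lemma B_equation_unique: "\<exists>!B. B_equation B"
proof -
  define F where "F B = 1 + ser_x * ser_y * B^2 * (ser_x * B^2 - (ser_x - 1) * (B - 1))"
    for B :: "int poly fps"
  have F_eq: "F B = 1 + fps_X * (ser_x * B^2 * (ser_x * B^2 - (ser_x - 1) * (B - 1)))" for B
    by (simp add: F_def ser_y_def algebra_simps)
  have "\<exists>!B. B = F B"
    by (rule contraction_unique_fixpoint)
       (auto simp: F_eq intro!: agree_add agree_diff agree_mult agree_power agree_X intro: agree_refl)
  then show ?thesis by (simp add: B_equation_def F_def)
qed

lemma B_ser_equation: "B_equation B_ser"
  unfolding B_ser_def by (rule theI') (rule B_equation_unique)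

end

theory Submission
  imports Defs
begin

text \<open>
  Build a sequence from the empty one by inserting the values in increasing order. A value \<open>a\<close>
  larger than all entries can be inserted at position \<open>q\<close> of \<open>e\<close> iff the first \<open>q\<close> entries are
  weakly increasing and \<open>a \<le> q\<close>, and likewise for a second copy of \<open>a\<close> at a later position. So the
  possible continuations depend only on the slack \<open>s\<close>, the number of values \<open>a\<close> that can be inserted
  at the end of the weakly increasing prefix. Let \<open>G s\<close> be the generating function of the
  continuations from slack \<open>s\<close>. With a second variable \<open>v\<close> marking the slack, the recursion
  for \<open>G\<close> becomes a linear equation whose kernel vanishes at \<open>v = 1 - 1/B\<close>; this yields
  \<open>B - 1 = x\<^sup>2 y B\<^sup>2 G 1\<close>, and together with the equation of \<open>B\<close> it gives
  \<open>x G 1 = x + (B - 1) (1 + x B)\<close>.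
\<close>

subsection \<open>Inserting a new maximum\<close>

text \<open>True iff putting \<open>a\<close> in front of \<open>e\<close> creates a 102 in which
  \<open>a\<close> plays the 1. Splitting off the head this way opens pattern avoidance to list
  induction.\<close>

fun dips :: "nat \<Rightarrow> nat list \<Rightarrow> bool" where
  "dips a [] \<longleftrightarrow> False"
| "dips a (b # e) \<longleftrightarrow> b < a \<and> (\<exists>c\<in>set e. a < c) \<or> dips a e"

text \<open>Splits on whether the smallest index is 0; this and its three-index version turn the
  index definitions into recursions over \<open>#\<close>.\<close>

lemma ex_less2_Suc:
  "(\<exists>j k. j < k \<and> k < Suc n \<and> P j k) \<longleftrightarrow>
   (\<exists>k<n. P 0 (Suc k)) \<or> (\<exists>j k. j < k \<and> k < n \<and> P (Suc j) (Suc k))" (is "?L \<longleftrightarrow> ?R")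
proof
  assume ?L
  then obtain j k where *: "j < k" "k < Suc n" "P j k" by blast
  then obtain k' where "k = Suc k'" by (cases k) auto
  with * show ?R by (cases j) auto
qed (auto intro: Suc_mono)

lemma ex_less3_Suc:
  "(\<exists>i j k. i < j \<and> j < k \<and> k < Suc n \<and> P i j k) \<longleftrightarrow>
   (\<exists>j k. j < k \<and> k < n \<and> P 0 (Suc j) (Suc k)) \<or>
   (\<exists>i j k. i < j \<and> j < k \<and> k < n \<and> P (Suc i) (Suc j) (Suc k))" (is "?L \<longleftrightarrow> ?R")
proof
  assume ?L
  then obtain i j k where *: "i < j" "j < k" "k < Suc n" "P i j k" by blast
  then obtain j' k' where "j = Suc j'" "k = Suc k'" by (cases j; cases k) auto
  with * show ?R by (cases i) auto
next
  assume ?R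
  then show ?L by (meson Suc_mono zero_less_Suc)
qed

lemma dips_iff_nth: "dips a e \<longleftrightarrow> (\<exists>j k. j < k \<and> k < length e \<and> e ! j < a \<and> a < e ! k)"
proof (induction e)
  case (Cons b e)
  have "(\<exists>k<length e. b < a \<and> a < e ! k) \<longleftrightarrow> b < a \<and> (\<exists>c\<in>set e. a < c)"
    by (metis in_set_conv_nth)
  then show ?case
    by (simp only: length_Cons ex_less2_Suc nth_Cons_0 nth_Cons_Suc dips.simps Cons.IH)
qed simp

lemma avoids_102_Nil: "avoids_102 []"
  by (simp add: avoids_102_def)

lemma avoids_102_Cons: "avoids_102 (a # e) \<longleftrightarrow> avoids_102 e \<and> \<not> dips a e"
  by (simp only: avoids_102_def dips_iff_nth length_Cons ex_less3_Suc nth_Cons_0 nth_Cons_Suc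
      de_Morgan_disj) (rule conj_commute)

text \<open>The entry \<open>v\<close> exceeds \<open>a\<close>, so it cannot serve as the 0, but as
  the 2 it completes every smaller entry before it.\<close>

lemma dips_insert_max:
  "a < v \<Longrightarrow> dips a (\<alpha> @ v # \<beta>) \<longleftrightarrow> dips a (\<alpha> @ \<beta>) \<or> (\<exists>b\<in>set \<alpha>. b < a)"
  by (induction \<alpha>) auto

lemma not_dips_max: "\<forall>x\<in>set e. x \<le> v \<Longrightarrow> \<not> dips v e"
  by (induction e) (auto simp: not_less)

text \<open>The new maximum can only play the role of the 2, so nothing before it may form a 10.\<close>

lemma avoids_102_insert_max:
  assumes "\<forall>x\<in>set \<alpha> \<union> set \<beta>. x \<le> v"
  shows "avoids_102 (\<alpha> @ v # \<beta>) \<longleftrightarrow> avoids_102 (\<alpha> @ \<beta>) \<and> sorted (filter (\<lambda>x. x < v) \<alpha>)"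
  using assms
proof (induction \<alpha>)
  case Nil
  then show ?case by (simp add: avoids_102_Cons not_dips_max)
next
  case (Cons a \<alpha>)
  show ?case
  proof (cases "a < v")
    case True
    then show ?thesis
      using Cons by (auto simp: avoids_102_Cons dips_insert_max not_less)
  next
    case False
    then have "a = v" using Cons.prems by auto
    then show ?thesis
      using Cons not_dips_max[of "\<alpha> @ v # \<beta>" v] not_dips_max[of "\<alpha> @ \<beta>" v]
      by (auto simp: avoids_102_Cons)
  qed
qed

text \<open>A 000 that uses the head consists of it and two copies of \<open>a\<close> in
  \<open>e\<close>.\<close>

lemma avoids_000_Cons: "avoids_000 (a # e) \<longleftrightarrow> avoids_000 e \<and> count_list e a \<le> 1"
proof -
  have *: "2 \<le> count_list e a \<longleftrightarrow> (\<exists>j k. j < k \<and> k < length e \<and> a = e ! j \<and> e ! j = e ! k)"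
  proof (induction e)
    case (Cons b e)
    have "(\<exists>k<length e. a = b \<and> b = e ! k) \<longleftrightarrow> a = b \<and> a \<in> set e"
      by (metis in_set_conv_nth)
    also have "a \<in> set e \<longleftrightarrow> 1 \<le> count_list e a"
      by (metis count_list_0_iff less_one not_less)
    finally have "(\<exists>k<length e. a = b \<and> b = e ! k) \<longleftrightarrow> a = b \<and> 1 \<le> count_list e a" .
    then show ?case
      unfolding length_Cons ex_less2_Suc nth_Cons_0 nth_Cons_Suc Cons.IH[symmetric]
      by simp linarith
  qed simp
  have "\<not> (\<exists>j k. j < k \<and> k < length e \<and> a = e ! j \<and> e ! j = e ! k) \<longleftrightarrow> count_list e a \<le> 1"
    by (simp only: flip: *) linarith
  then show ?thesis
    by (simp only: avoids_000_def length_Cons ex_less3_Suc nth_Cons_0 nth_Cons_Suc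
        de_Morgan_disj) (rule conj_commute)
qed

lemma avoids_000_iff_count: "avoids_000 e \<longleftrightarrow> (\<forall>x. count_list e x \<le> 2)"
proof (induction e)
  case Nil
  then show ?case by (simp add: avoids_000_def)
next
  case (Cons a e)
  have "(\<forall>x. count_list (a # e) x \<le> 2) \<longleftrightarrow> (\<forall>x. count_list e x \<le> 2) \<and> count_list e a \<le> 1"
    (is "?L \<longleftrightarrow> ?R")
  proof
    assume L: ?L
    have "count_list e x \<le> 2" for x using L[rule_format, of x] by (simp split: if_splits)
    moreover have "count_list e a \<le> 1" using L[rule_format, of a] by simp
    ultimately show ?R by blast
  qed auto
  with Cons.IH show ?case by (simp add: avoids_000_Cons)
qed

text \<open>The offset \<open>k\<close> is the position of the first entry inside a longer list;
  with it the inversion bound splits over append.\<close>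

fun below_index :: "nat \<Rightarrow> nat list \<Rightarrow> bool" where
  "below_index k [] \<longleftrightarrow> True"
| "below_index k (a # e) \<longleftrightarrow> a \<le> k \<and> below_index (Suc k) e"

lemma below_index_append:
  "below_index k (e @ f) \<longleftrightarrow> below_index k e \<and> below_index (k + length e) f"
  by (induction e arbitrary: k) auto

lemma below_index_if_bounded: "\<forall>x\<in>set e. x \<le> k \<Longrightarrow> below_index k e"
  by (induction e arbitrary: k) (auto simp: le_SucI)

lemma below_index_iff_nth: "below_index k e \<longleftrightarrow> (\<forall>i<length e. e ! i \<le> k + i)"
proof (induction e arbitrary: k)
  case (Cons a e)
  show ?case by (auto simp: Cons.IH less_Suc_eq_0_disj)
qed simp

lemma inversion_seqs_iff: "e \<in> inversion_seqs n \<longleftrightarrow> length e = n \<and> below_index 0 e"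
  by (auto simp: inversion_seqs_def below_index_iff_nth)

definition good :: "nat list \<Rightarrow> bool" where
  "good e \<longleftrightarrow> below_index 0 e \<and> avoids_102 e \<and> avoids_000 e"

text \<open>Inserting or deleting \<open>v\<close> shifts \<open>\<beta>\<close> by one place. Once
  \<open>v \<le> length \<alpha>\<close>, the index bound on \<open>\<beta>\<close> holds in either
  position, since its entries are below \<open>v\<close>. A value absent from both parts cannot
  create a 000.\<close>

lemma good_insert_max:
  assumes "\<forall>x\<in>set \<alpha> \<union> set \<beta>. x < v"
  shows "good (\<alpha> @ v # \<beta>) \<longleftrightarrow> good (\<alpha> @ \<beta>) \<and> sorted \<alpha> \<and> v \<le> length \<alpha>"
    (is "good ?new \<longleftrightarrow> good ?old \<and> _")
proof -
  have 1: "avoids_102 (\<alpha> @ v # \<beta>) \<longleftrightarrow> avoids_102 (\<alpha> @ \<beta>) \<and> sorted \<alpha>"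
    using assms by (subst avoids_102_insert_max) (auto simp: less_imp_le)
  have 2: "avoids_000 (\<alpha> @ v # \<beta>) \<longleftrightarrow> avoids_000 (\<alpha> @ \<beta>)"
  proof -
    have "count_list \<alpha> v = 0" "count_list \<beta> v = 0"
      using assms by (auto simp: count_list_0_iff)
    then have "count_list ?new x \<le> 2 \<longleftrightarrow> count_list ?old x \<le> 2" for x
      by (cases "x = v") simp_all
    then show ?thesis by (simp only: avoids_000_iff_count)
  qed
  have "below_index k \<beta>" if "v \<le> k" for k
    using assms that
    by (auto intro!: below_index_if_bounded intro: less_imp_le less_le_trans)
  then have "below_index 0 ?new \<longleftrightarrow> below_index 0 ?old \<and> v \<le> length \<alpha>"
    by (auto simp: below_index_append)
  with 1 2 show ?thesis
    unfolding good_def by blast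
qed

lemma good_insert_max_twice:
  assumes "\<forall>x\<in>set \<alpha> \<union> set \<gamma> \<union> set \<beta>. x < v"
  shows "good (\<alpha> @ v # \<gamma> @ v # \<beta>) \<longleftrightarrow>
    good (\<alpha> @ \<gamma> @ \<beta>) \<and> sorted (\<alpha> @ \<gamma>) \<and> v \<le> length \<alpha>"
    (is "good ?new \<longleftrightarrow> good ?old \<and> _")
proof -
  \<comment> \<open>The later copy is removed first. The prefix before it already contains a
    \<open>v\<close>, which the filter to entries below \<open>v\<close> discards; for this the
    lemma on inserting a maximum allows entries equal to \<open>v\<close>.\<close>
  have "avoids_102 ((\<alpha> @ v # \<gamma>) @ v # \<beta>) \<longleftrightarrow> avoids_102 (\<alpha> @ v # \<gamma> @ \<beta>) \<and> sorted (\<alpha> @ \<gamma>)"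
    using assms by (subst avoids_102_insert_max) (auto simp: less_imp_le)
  moreover have "avoids_102 (\<alpha> @ v # \<gamma> @ \<beta>) \<longleftrightarrow> avoids_102 (\<alpha> @ \<gamma> @ \<beta>) \<and> sorted \<alpha>"
    using assms by (subst avoids_102_insert_max) (auto simp: less_imp_le)
  ultimately have 1: "avoids_102 (\<alpha> @ v # \<gamma> @ v # \<beta>) \<longleftrightarrow>
      avoids_102 (\<alpha> @ \<gamma> @ \<beta>) \<and> sorted (\<alpha> @ \<gamma>)"
    by (auto simp: sorted_append)
  have 2: "avoids_000 (\<alpha> @ v # \<gamma> @ v # \<beta>) \<longleftrightarrow> avoids_000 (\<alpha> @ \<gamma> @ \<beta>)"
  proof -
    have "count_list \<alpha> v = 0" "count_list \<gamma> v = 0" "count_list \<beta> v = 0"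
      using assms by (auto simp: count_list_0_iff)
    then have "count_list ?new x \<le> 2 \<longleftrightarrow> count_list ?old x \<le> 2" for x
      by (cases "x = v") simp_all
    then show ?thesis by (simp only: avoids_000_iff_count)
  qed
  have "below_index k \<gamma>" "below_index k \<beta>" if "v \<le> k" for k
    using assms that
    by (auto intro!: below_index_if_bounded intro: less_imp_le less_le_trans)
  then have "below_index 0 ?new \<longleftrightarrow> below_index 0 ?old \<and> v \<le> length \<alpha>"
    by (auto simp: below_index_append)
  with 1 2 show ?thesis
    unfolding good_def by blast
qed

section \<open>Bound, run and slack of a sequence\<close>

definition bound :: "nat list \<Rightarrow> nat" where
  "bound e = Max (insert 0 (Suc ` set e))"

definition run :: "nat list \<Rightarrow> nat" where
  "run e = Max {q. q \<le> length e \<and> sorted (take q e)}"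

lemma bound_le_iff: "bound e \<le> v \<longleftrightarrow> (\<forall>x\<in>set e. x < v)"
  by (simp add: bound_def Suc_le_eq)

lemma le_run_iff: "q \<le> run e \<longleftrightarrow> q \<le> length e \<and> sorted (take q e)"
proof -
  let ?Q = "{q. q \<le> length e \<and> sorted (take q e)}"
  have fin: "finite ?Q" by (rule finite_subset[of _ "{..length e}"]) auto
  have "0 \<in> ?Q" by simp
  then have "run e \<in> ?Q" unfolding run_def using Max_in[OF fin] by blast
  moreover have "sorted (take q e)" if "q \<le> run e" "sorted (take (run e) e)"
    using sorted_wrt_take[of "(\<le>)" "take (run e) e" q] that by (simp add: min_def)
  moreover have "q \<le> run e" if "q \<in> ?Q"
    unfolding run_def using fin that by simp
  ultimately show ?thesis by auto
qed

text \<open>At position \<open>run e\<close> the insertable values are those from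
  \<open>bound e\<close> to \<open>run e\<close>; this is their number, and truncated subtraction
  gives 0 if there are none.\<close>

definition slack :: "nat list \<Rightarrow> nat" where
  "slack e = run e + 1 - bound e"

lemma bound_eqI:
  assumes "v \<in> set e" "\<forall>x\<in>set e. x \<le> v"
  shows "bound e = Suc v"
proof (rule order.antisym)
  show "bound e \<le> Suc v" using assms(2) by (auto simp: bound_le_iff less_Suc_eq_le)
  have "\<not> bound e \<le> v" using assms(1) by (auto simp: bound_le_iff)
  then show "Suc v \<le> bound e" by simp
qed

lemma run_eqI:
  assumes "sorted \<alpha>" and "\<beta> = [] \<or> (\<alpha> \<noteq> [] \<and> hd \<beta> < last \<alpha>)"
  shows "run (\<alpha> @ \<beta>) = length \<alpha>"
proof (rule order.antisym)
  show "length \<alpha> \<le> run (\<alpha> @ \<beta>)" using assms by (simp add: le_run_iff)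
  show "run (\<alpha> @ \<beta>) \<le> length \<alpha>"
  proof (rule ccontr)
    assume "\<not> ?thesis"
    then have "Suc (length \<alpha>) \<le> run (\<alpha> @ \<beta>)" by simp
    then have *: "Suc (length \<alpha>) \<le> length (\<alpha> @ \<beta>)" "sorted (take (Suc (length \<alpha>)) (\<alpha> @ \<beta>))"
      unfolding le_run_iff by auto
    then have "\<beta> \<noteq> []" by auto
    then obtain b \<beta>' where "\<beta> = b # \<beta>'" by (cases \<beta>) auto
    with * have "\<forall>x\<in>set \<alpha>. x \<le> b" by (auto simp: sorted_append)
    moreover have "\<alpha> \<noteq> []" "b < last \<alpha>" using assms(2) \<open>\<beta> = b # \<beta>'\<close> by auto
    ultimately show False using last_in_set[of \<alpha>] by (meson leD)
  qed
qed

text \<open>The bound becomes \<open>v + 1\<close>, and the run ends right after \<open>v\<close>,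
  because any following entry is smaller.\<close>

lemma slack_insert_max:
  assumes "\<forall>x\<in>set \<alpha> \<union> set \<beta>. x < v" "sorted \<alpha>"
  shows "slack (\<alpha> @ v # \<beta>) = length \<alpha> + 1 - v"
proof -
  have "bound (\<alpha> @ v # \<beta>) = Suc v"
    using assms by (intro bound_eqI) (auto simp: less_imp_le)
  moreover have "run ((\<alpha> @ [v]) @ \<beta>) = length (\<alpha> @ [v])"
    using assms by (intro run_eqI) (auto simp: sorted_append less_imp_le)
  ultimately show ?thesis by (simp add: slack_def)
qed

text \<open>Adjacent copies both belong to the run. Otherwise the first entry of
  \<open>\<gamma>\<close> is a descent right after the first copy, and the slack is that of a single
  insertion.\<close>

lemma slack_insert_max_twice:
  assumes "\<forall>x\<in>set \<alpha> \<union> set \<gamma> \<union> set \<beta>. x < v" "sorted \<alpha>"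
  shows "slack (\<alpha> @ v # \<gamma> @ v # \<beta>) = length \<alpha> + (if \<gamma> = [] then 2 else 1) - v"
proof -
  have b: "bound (\<alpha> @ v # \<gamma> @ v # \<beta>) = Suc v"
    using assms by (intro bound_eqI) (auto simp: less_imp_le)
  show ?thesis
  proof (cases "\<gamma> = []")
    case True
    have "run ((\<alpha> @ [v, v]) @ \<beta>) = length (\<alpha> @ [v, v])"
      using assms by (intro run_eqI) (auto simp: sorted_append less_imp_le)
    with b True show ?thesis by (simp add: slack_def)
  next
    case False
    have "run ((\<alpha> @ [v]) @ \<gamma> @ v # \<beta>) = length (\<alpha> @ [v])"
      using assms False by (intro run_eqI) (auto simp: sorted_append less_imp_le)
    with b False show ?thesis by (simp add: slack_def)
  qed
qed

subsection \<open>The generating tree\<close>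

definition good_seqs :: "nat \<Rightarrow> nat list set" where
  "good_seqs m = {e. good e \<and> card (set e) = m}"

definition slots :: "nat list \<Rightarrow> (nat \<times> nat) set" where
  "slots e = {(v, q). bound e \<le> v \<and> v \<le> q \<and> q \<le> run e}"

definition insert_at :: "nat list \<times> nat \<times> nat \<Rightarrow> nat list" where
  "insert_at = (\<lambda>(e, v, q). take q e @ v # drop q e)"

text \<open>Both positions refer to \<open>e\<close> before any insertion, so \<open>q' = q\<close>
  encodes adjacent copies.\<close>

definition double_slots :: "nat list \<Rightarrow> (nat \<times> nat \<times> nat) set" where
  "double_slots e = {(v, q, q'). bound e \<le> v \<and> v \<le> q \<and> q \<le> q' \<and> q' \<le> run e}"

definition insert_twice_at :: "nat list \<times> nat \<times> nat \<times> nat \<Rightarrow> nat list" where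
  "insert_twice_at = (\<lambda>(e, v, q, q'). take q e @ v # drop q (take q' e) @ v # drop q' e)"

text \<open>No value occurs more than twice. The bound is what makes \<open>good_seqs\<close>
  finite.\<close>

lemma length_le_if_good:
  assumes "good e"
  shows "length e \<le> 2 * card (set e)"
proof -
  have "length e = (\<Sum>x\<in>set e. count_list e x)" by (simp add: sum_count_set)
  also have "\<dots> \<le> (\<Sum>x\<in>set e. 2)"
    using assms by (intro sum_mono) (simp add: good_def avoids_000_iff_count)
  finally show ?thesis by simp
qed

lemma finite_good_seqs: "finite (good_seqs m)"
proof (rule finite_subset)
  show "good_seqs m \<subseteq> {e. set e \<subseteq> {..2 * m} \<and> length e \<le> 2 * m}"
  proof
    fix e assume "e \<in> good_seqs m"
    then have e: "good e" "length e \<le> 2 * m"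
      using length_le_if_good by (auto simp: good_seqs_def)
    then have "x \<le> 2 * m" if "x \<in> set e" for x
      using that by (fastforce simp: good_def below_index_iff_nth in_set_conv_nth)
    with e show "e \<in> {e. set e \<subseteq> {..2 * m} \<and> length e \<le> 2 * m}" by auto
  qed
qed (rule finite_lists_length_le, simp)

lemma good_seqs_0: "good_seqs 0 = {[]}"
  by (auto simp: good_seqs_def good_def avoids_102_Nil avoids_000_def)

lemma slots_append:
  "(v, length \<alpha>) \<in> slots (\<alpha> @ \<beta>) \<longleftrightarrow>
    (\<forall>x\<in>set \<alpha> \<union> set \<beta>. x < v) \<and> sorted \<alpha> \<and> v \<le> length \<alpha>"
  by (auto simp: slots_def bound_le_iff le_run_iff)

lemma slotsE:
  assumes "(v, q) \<in> slots e"
  obtains \<alpha> \<beta> where "e = \<alpha> @ \<beta>" "q = length \<alpha>"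
    "\<forall>x\<in>set \<alpha> \<union> set \<beta>. x < v" "sorted \<alpha>" "v \<le> length \<alpha>"
proof -
  have "q \<le> length e" using assms by (auto simp: slots_def le_run_iff)
  then have "length (take q e) = q" by simp
  with that[of "take q e" "drop q e"] assms slots_append[of v "take q e" "drop q e"]
  show ?thesis by simp
qed

lemma double_slots_append:
  "(v, length \<alpha>, length \<alpha> + length \<gamma>) \<in> double_slots (\<alpha> @ \<gamma> @ \<beta>) \<longleftrightarrow>
    (\<forall>x\<in>set \<alpha> \<union> set \<gamma> \<union> set \<beta>. x < v) \<and> sorted (\<alpha> @ \<gamma>) \<and> v \<le> length \<alpha>"
  by (auto simp: double_slots_def bound_le_iff le_run_iff)

lemma double_slotsE:
  assumes "(v, q, q') \<in> double_slots e"
  obtains \<alpha> \<gamma> \<beta> where "e = \<alpha> @ \<gamma> @ \<beta>" "q = length \<alpha>" "q' = length \<alpha> + length \<gamma>"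
    "\<forall>x\<in>set \<alpha> \<union> set \<gamma> \<union> set \<beta>. x < v" "sorted (\<alpha> @ \<gamma>)" "v \<le> length \<alpha>"
proof -
  have q: "q \<le> q'" "q' \<le> length e" using assms by (auto simp: double_slots_def le_run_iff)
  then have l: "length (take q e) = q" "length (take q e) + length (drop q (take q' e)) = q'"
    by simp_all
  have "take q e @ drop q (take q' e) = take q' e"
    using append_take_drop_id[of q "take q' e"] q by (simp add: min_def)
  then have "take q e @ drop q (take q' e) @ drop q' e = e"
    by (metis append.assoc append_take_drop_id)
  with that[of "take q e" "drop q (take q' e)" "drop q' e"] assms l
    double_slots_append[of v "take q e" "drop q (take q' e)" "drop q' e"]
  show ?thesis by simp
qed

lemma Max_insert_greater:
  fixes v :: nat
  shows "finite A \<Longrightarrow> \<forall>x\<in>A. x < v \<Longrightarrow> Max (insert v A) = v"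
  by (intro Max_eqI) (auto simp: less_imp_le)

text \<open>The inverse deletes the maximum: its value recovers \<open>v\<close>, and its only
  occurrence recovers the position.\<close>

lemma bij_betw_insert_at:
  "bij_betw insert_at (SIGMA e:good_seqs m. slots e)
    {e \<in> good_seqs (Suc m). count_list e (Max (set e)) = 1}" (is "bij_betw _ ?A ?B")
proof (rule bij_betw_imageI)
  show "inj_on insert_at ?A"
  proof (rule inj_onI)
    fix p p' assume pp: "p \<in> ?A" "p' \<in> ?A" "insert_at p = insert_at p'"
    obtain e v q e' v' q' where p: "p = (e, v, q)" "p' = (e', v', q')"
      by (metis prod.exhaust)
    from pp p have s: "(v, q) \<in> slots e" "(v', q') \<in> slots e'" by auto
    from s(1) obtain \<alpha> \<beta> where 1: "e = \<alpha> @ \<beta>" "q = length \<alpha>" "\<forall>x\<in>set \<alpha> \<union> set \<beta>. x < v"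
      by (rule slotsE)
    from s(2) obtain \<alpha>' \<beta>' where 2: "e' = \<alpha>' @ \<beta>'" "q' = length \<alpha>'" "\<forall>x\<in>set \<alpha>' \<union> set \<beta>'. x < v'"
      by (rule slotsE)
    from pp p 1 2 have eq: "\<alpha> @ v # \<beta> = \<alpha>' @ v' # \<beta>'" by (simp add: insert_at_def)
    have "Max (set (\<alpha> @ v # \<beta>)) = v" "Max (set (\<alpha>' @ v' # \<beta>')) = v'"
      using 1 2 by (simp_all add: Max_insert_greater Un_assoc)
    with eq have "v = v'" by metis
    moreover from this eq have "\<alpha> = \<alpha>' \<and> \<beta> = \<beta>'"
      using 1 append_Cons_eq_iff[of v \<alpha> \<beta> \<alpha>' \<beta>'] by auto
    ultimately show "p = p'" using p 1 2 by simp
  qed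
next
  show "insert_at ` ?A = ?B"
  proof (intro equalityI subsetI)
    fix f assume "f \<in> insert_at ` ?A"
    then obtain e v q where e: "e \<in> good_seqs m" "(v, q) \<in> slots e" "f = insert_at (e, v, q)"
      by auto
    from e(2) obtain \<alpha> \<beta> where 1: "e = \<alpha> @ \<beta>" "q = length \<alpha>"
      "\<forall>x\<in>set \<alpha> \<union> set \<beta>. x < v" "sorted \<alpha>" "v \<le> length \<alpha>"
      by (rule slotsE)
    have f: "f = \<alpha> @ v # \<beta>" using e 1 by (simp add: insert_at_def)
    have "Max (set f) = v"
      using 1 unfolding f by (simp add: Max_insert_greater Un_assoc)
    moreover have notin: "v \<notin> set \<alpha>" "v \<notin> set \<beta>" using 1(3) by auto
    moreover have "card (set f) = Suc (card (set e))"
      using notin f 1 by simp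
    moreover have "good f" using e good_insert_max[OF 1(3)] 1 f by (simp add: good_seqs_def)
    moreover have "count_list f v = 1"
      using notin f by (simp add: count_list_0_iff)
    ultimately show "f \<in> ?B" using e by (simp add: good_seqs_def)
  next
    fix f assume f: "f \<in> ?B"
    define v where "v = Max (set f)"
    have "set f \<noteq> {}" using f by (auto simp: good_seqs_def)
    then have v: "v \<in> set f" "\<forall>x\<in>set f. x \<le> v" by (simp_all add: v_def)
    then obtain \<alpha> \<beta> where \<alpha>: "f = \<alpha> @ v # \<beta>" by (meson split_list)
    moreover have "count_list f v = 1" using f by (simp add: v_def)
    ultimately have "count_list \<alpha> v = 0" "count_list \<beta> v = 0" by simp_all
    then have notin: "v \<notin> set \<alpha>" "v \<notin> set \<beta>" by (simp_all add: count_list_0_iff)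
    have less: "\<forall>x\<in>set \<alpha> \<union> set \<beta>. x < v"
      using v \<alpha> notin by (auto simp: order.strict_iff_order)
    have "good (\<alpha> @ \<beta>)" "sorted \<alpha>" "v \<le> length \<alpha>"
      using good_insert_max[OF less] f \<alpha> by (auto simp: good_seqs_def)
    moreover have "card (set (\<alpha> @ \<beta>)) = m" using f \<alpha> notin by (simp add: good_seqs_def)
    ultimately have "(\<alpha> @ \<beta>, v, length \<alpha>) \<in> ?A"
      using less slots_append[of v \<alpha> \<beta>] by (simp add: good_seqs_def)
    moreover have "f = insert_at (\<alpha> @ \<beta>, v, length \<alpha>)" by (simp add: \<alpha> insert_at_def)
    ultimately show "f \<in> insert_at ` ?A" by (rule rev_image_eqI)
  qed
qed

text \<open>A nonempty good sequence has its maximum once or twice, so the target is the case of two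
  copies. Deleting both is the inverse.\<close>

lemma bij_betw_insert_twice_at:
  "bij_betw insert_twice_at (SIGMA e:good_seqs m. double_slots e)
    {e \<in> good_seqs (Suc m). count_list e (Max (set e)) \<noteq> 1}" (is "bij_betw _ ?A ?B")
proof (rule bij_betw_imageI)
  show "inj_on insert_twice_at ?A"
  proof (rule inj_onI)
    fix p p' assume pp: "p \<in> ?A" "p' \<in> ?A" "insert_twice_at p = insert_twice_at p'"
    obtain e v q r e' v' q' r' where p: "p = (e, v, q, r)" "p' = (e', v', q', r')"
      by (metis prod.exhaust)
    from pp p have s: "(v, q, r) \<in> double_slots e" "(v', q', r') \<in> double_slots e'" by auto
    from s(1) obtain \<alpha> \<gamma> \<beta> where 1: "e = \<alpha> @ \<gamma> @ \<beta>" "q = length \<alpha>" "r = length \<alpha> + length \<gamma>"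
      "\<forall>x\<in>set \<alpha> \<union> set \<gamma> \<union> set \<beta>. x < v"
      by (rule double_slotsE)
    from s(2) obtain \<alpha>' \<gamma>' \<beta>' where 2: "e' = \<alpha>' @ \<gamma>' @ \<beta>'" "q' = length \<alpha>'"
      "r' = length \<alpha>' + length \<gamma>'" "\<forall>x\<in>set \<alpha>' \<union> set \<gamma>' \<union> set \<beta>'. x < v'"
      by (rule double_slotsE)
    from pp p 1 2 have eq: "\<alpha> @ v # \<gamma> @ v # \<beta> = \<alpha>' @ v' # \<gamma>' @ v' # \<beta>'"
      by (simp add: insert_twice_at_def)
    have "Max (set (\<alpha> @ v # \<gamma> @ v # \<beta>)) = v" "Max (set (\<alpha>' @ v' # \<gamma>' @ v' # \<beta>')) = v'"
      using 1 2 by (simp_all add: Max_insert_greater Un_assoc)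
    with eq have v: "v = v'" by metis
    have notin: "v \<notin> set \<alpha>" "v \<notin> set \<gamma>" "v \<notin> set \<beta>" "v \<notin> set \<alpha>'" "v \<notin> set \<gamma>'" "v \<notin> set \<beta>'"
      using 1 2 v by auto
    have "\<alpha> = \<alpha>' \<and> \<gamma> @ v # \<beta> = \<gamma>' @ v # \<beta>'"
      using eq notin v by (auto simp: append_eq_Cons_conv Cons_eq_append_conv append_eq_append_conv2)
    moreover from this have "\<gamma> = \<gamma>' \<and> \<beta> = \<beta>'"
      using notin append_Cons_eq_iff[of v \<gamma> \<beta> \<gamma>' \<beta>'] by auto
    ultimately show "p = p'" using p v 1 2 by simp
  qed
next
  show "insert_twice_at ` ?A = ?B"
  proof (intro equalityI subsetI)
    fix f assume "f \<in> insert_twice_at ` ?A"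
    then obtain e v q r where e: "e \<in> good_seqs m" "(v, q, r) \<in> double_slots e"
      "f = insert_twice_at (e, v, q, r)"
      by auto
    from e(2) obtain \<alpha> \<gamma> \<beta> where 1: "e = \<alpha> @ \<gamma> @ \<beta>" "q = length \<alpha>" "r = length \<alpha> + length \<gamma>"
      "\<forall>x\<in>set \<alpha> \<union> set \<gamma> \<union> set \<beta>. x < v" "sorted (\<alpha> @ \<gamma>)" "v \<le> length \<alpha>"
      by (rule double_slotsE)
    have f: "f = \<alpha> @ v # \<gamma> @ v # \<beta>" using e 1 by (simp add: insert_twice_at_def)
    have "Max (set f) = v"
      using 1 unfolding f by (simp add: Max_insert_greater Un_assoc)
    moreover have notin: "v \<notin> set \<alpha>" "v \<notin> set \<gamma>" "v \<notin> set \<beta>" using 1(4) by auto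
    moreover have "card (set f) = Suc (card (set e))"
      using notin f 1 by simp
    moreover have "good f" using e good_insert_max_twice[OF 1(4)] 1 f by (simp add: good_seqs_def)
    moreover have "count_list f v \<noteq> 1"
      using notin f by (simp add: count_list_0_iff)
    ultimately show "f \<in> ?B" using e by (simp add: good_seqs_def)
  next
    fix f assume f: "f \<in> ?B"
    define v where "v = Max (set f)"
    have "set f \<noteq> {}" using f by (auto simp: good_seqs_def)
    then have v: "v \<in> set f" "\<forall>x\<in>set f. x \<le> v" by (simp_all add: v_def)
    then obtain \<alpha> \<delta> where \<alpha>: "f = \<alpha> @ v # \<delta>" "v \<notin> set \<alpha>" by (meson split_list_first)
    have "count_list f v \<noteq> 1" using f by (simp add: v_def)
    with \<alpha> have "v \<in> set \<delta>" by (auto simp: count_list_0_iff)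
    then obtain \<gamma> \<beta> where "\<delta> = \<gamma> @ v # \<beta>" by (meson split_list)
    with \<alpha> have f_eq: "f = \<alpha> @ v # \<gamma> @ v # \<beta>" by simp
    have "count_list f v \<le> 2" using f by (simp add: good_seqs_def good_def avoids_000_iff_count)
    then have "count_list \<alpha> v = 0" "count_list \<gamma> v = 0" "count_list \<beta> v = 0" by (simp_all add: f_eq)
    then have notin: "v \<notin> set \<alpha>" "v \<notin> set \<gamma>" "v \<notin> set \<beta>" by (simp_all add: count_list_0_iff)
    have less: "\<forall>x\<in>set \<alpha> \<union> set \<gamma> \<union> set \<beta>. x < v"
      using v f_eq notin by (auto simp: order.strict_iff_order)
    have "good (\<alpha> @ \<gamma> @ \<beta>)" "sorted (\<alpha> @ \<gamma>)" "v \<le> length \<alpha>"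
      using good_insert_max_twice[OF less] f f_eq by (auto simp: good_seqs_def)
    moreover have "card (set (\<alpha> @ \<gamma> @ \<beta>)) = m" using f f_eq notin by (simp add: good_seqs_def)
    ultimately have "(\<alpha> @ \<gamma> @ \<beta>, v, length \<alpha>, length \<alpha> + length \<gamma>) \<in> ?A"
      using less double_slots_append[of v \<alpha> \<gamma> \<beta>] by (simp add: good_seqs_def)
    moreover have "f = insert_twice_at (\<alpha> @ \<gamma> @ \<beta>, v, length \<alpha>, length \<alpha> + length \<gamma>)"
      by (simp add: f_eq insert_twice_at_def)
    ultimately show "f \<in> insert_twice_at ` ?A" by (rule rev_image_eqI)
  qed
qed

lemma slack_insert_at: "(v, q) \<in> slots e \<Longrightarrow> slack (insert_at (e, v, q)) = q + 1 - v"
  by (elim slotsE) (simp add: insert_at_def slack_insert_max)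

lemma slack_insert_twice_at:
  "(v, q, q') \<in> double_slots e \<Longrightarrow>
    slack (insert_twice_at (e, v, q, q')) = q + (if q' = q then 2 else 1) - v"
  by (elim double_slotsE) (simp add: insert_twice_at_def slack_insert_max_twice sorted_append)

lemma length_insert_at: "(v, q) \<in> slots e \<Longrightarrow> length (insert_at (e, v, q)) = Suc (length e)"
  by (elim slotsE) (simp add: insert_at_def)

lemma length_insert_twice_at:
  "(v, q, q') \<in> double_slots e \<Longrightarrow>
    length (insert_twice_at (e, v, q, q')) = Suc (Suc (length e))"
  by (elim double_slotsE) (simp add: insert_twice_at_def)

section \<open>Counting slots by the distance from value to position\<close>

lemma finite_slots: "finite (slots e)"
  by (rule finite_subset[of _ "{..run e} \<times> {..run e}"]) (auto simp: slots_def)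

lemma finite_double_slots: "finite (double_slots e)"
  by (rule finite_subset[of _ "{..run e} \<times> {..run e} \<times> {..run e}"]) (auto simp: double_slots_def)

lemma sum_slots:
  fixes \<psi> :: "nat \<Rightarrow> 'a::comm_ring_1"
  shows "(\<Sum>(v, q)\<in>slots e. \<psi> (q - v)) = (\<Sum>d<slack e. of_nat (slack e - d) * \<psi> d)"
proof -
  \<comment> \<open>For fixed \<open>d = q - v\<close>, the constraint \<open>q \<le> run e\<close>
    leaves the values from \<open>bound e\<close> to \<open>run e - d\<close>.\<close>
  let ?S = "SIGMA d:{..<slack e}. {bound e..<bound e + (slack e - d)}"
  have "(\<Sum>(v, q)\<in>slots e. \<psi> (q - v)) = (\<Sum>(d, v)\<in>?S. \<psi> d)"
    by (rule sum.reindex_bij_witness[where j = "\<lambda>(v, q). (q - v, v)" and i = "\<lambda>(d, v). (v, v + d)"])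
       (auto simp: slots_def slack_def)
  also have "\<dots> = (\<Sum>d<slack e. of_nat (slack e - d) * \<psi> d)"
    by (simp flip: sum.Sigma)
  finally show ?thesis .
qed

lemma sum_lessThan_id: "(\<Sum>i<n. i) = n choose 2"
  by (induction n) (simp_all add: numeral_2_eq_2)

lemma sum_double_slots:
  fixes \<psi> \<psi>' :: "nat \<Rightarrow> 'a::comm_ring_1"
  shows "(\<Sum>(v, q, q')\<in>double_slots e. if q' = q then \<psi> (q - v) else \<psi>' (q - v)) =
    (\<Sum>d<slack e. of_nat (slack e - d) * \<psi> d) + (\<Sum>d<slack e. of_nat ((slack e - d) choose 2) * \<psi>' d)"
proof -
  let ?f = "\<lambda>(v, q, q'). if q' = q then \<psi> (q - v) else \<psi>' (q - v)"
  let ?D = "{(v, q, q') \<in> double_slots e. q' = q}" and ?N = "{(v, q, q') \<in> double_slots e. q' \<noteq> q}"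
  \<comment> \<open>For separated copies, \<open>j = v - bound e\<close> and
    \<open>i = q' - d - bound e\<close> turn \<open>q < q'\<close> into \<open>j < i\<close> and
    \<open>q' \<le> run e\<close> into \<open>i < slack e - d\<close>; counting such pairs gives the
    binomial coefficient.\<close>
  let ?S = "SIGMA d:{..<slack e}. SIGMA i:{..<slack e - d}. {..<i}"
  have "sum ?f (double_slots e) = sum ?f ?D + sum ?f ?N"
    by (subst sum.union_disjoint[symmetric])
       (auto intro!: finite_subset[OF _ finite_double_slots[of e]] sum.cong)
  moreover have "sum ?f ?D = (\<Sum>(v, q)\<in>slots e. \<psi> (q - v))"
    by (rule sum.reindex_bij_witness[where j = "\<lambda>(v, q, q'). (v, q)" and i = "\<lambda>(v, q). (v, q, q)"])
       (auto simp: slots_def double_slots_def)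
  moreover have "sum ?f ?N = (\<Sum>(d, i, j)\<in>?S. \<psi>' d)"
    by (rule sum.reindex_bij_witness[where j = "\<lambda>(v, q, q'). (q - v, q' - (q - v) - bound e, v - bound e)"
          and i = "\<lambda>(d, i, j). (j + bound e, j + bound e + d, i + bound e + d)"])
       (auto simp: double_slots_def slack_def)
  moreover have "(\<Sum>(d, i, j)\<in>?S. \<psi>' d) =
      (\<Sum>d<slack e. \<Sum>(i, j)\<in>(SIGMA i:{..<slack e - d}. {..<i}). \<psi>' d)"
    by (subst sum.Sigma) (auto simp: split_def)
  moreover have "\<dots> = (\<Sum>d<slack e. of_nat ((slack e - d) choose 2) * \<psi>' d)"
    by (simp add: sum_lessThan_id)
  ultimately show ?thesis by (simp add: sum_slots)
qed

text \<open>
  Here \<open>d = q - v\<close>: there are \<open>s - d\<close> slots \<open>(v, q)\<close> for each \<open>d < s\<close>, and inserting \<open>v\<close> once leaves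
  slack \<open>d + 1\<close>. A second copy leaves slack \<open>d + 2\<close> if adjacent to the first, and \<open>d + 1\<close> otherwise.
\<close>

definition step :: "'a::comm_ring_1 \<Rightarrow> (nat \<Rightarrow> 'a) \<Rightarrow> nat \<Rightarrow> 'a" where
  "step x \<phi> s = x * (\<Sum>d<s. of_nat (s - d) * \<phi> (d + 1)) +
    x\<^sup>2 * ((\<Sum>d<s. of_nat (s - d) * \<phi> (d + 2)) + (\<Sum>d<s. of_nat ((s - d) choose 2) * \<phi> (d + 1)))"

text \<open>Each sequence with \<open>m + 1\<close> distinct values has a unique parent, obtained by
  deleting its maximum. The total weight of the children of \<open>e\<close> depends only on its
  length and slack, so one level of the tree is traded for one application of \<open>step\<close> to
  \<open>\<phi>\<close>.\<close>

lemma sum_good_seqs_Suc: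
  fixes x :: "'a::comm_ring_1"
  shows "(\<Sum>e\<in>good_seqs (Suc m). x ^ length e * \<phi> (slack e)) =
    (\<Sum>e\<in>good_seqs m. x ^ length e * step x \<phi> (slack e))"
proof -
  let ?f = "\<lambda>e. x ^ length e * \<phi> (slack e)"
  let ?B1 = "{e \<in> good_seqs (Suc m). count_list e (Max (set e)) = 1}"
    and ?B2 = "{e \<in> good_seqs (Suc m). count_list e (Max (set e)) \<noteq> 1}"
  have "sum ?f (good_seqs (Suc m)) = sum ?f ?B1 + sum ?f ?B2"
    by (subst sum.union_disjoint[symmetric])
       (auto intro!: finite_subset[OF _ finite_good_seqs[of "Suc m"]] sum.cong)
  also have "sum ?f ?B1 = (\<Sum>p\<in>(SIGMA e:good_seqs m. slots e). ?f (insert_at p))"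
    by (rule sum.reindex_bij_betw[OF bij_betw_insert_at, symmetric])
  also have "\<dots> = (\<Sum>e\<in>good_seqs m. \<Sum>(v, q)\<in>slots e. ?f (insert_at (e, v, q)))"
    by (subst sum.Sigma) (simp_all add: finite_good_seqs finite_slots split_def)
  also have "\<dots> = (\<Sum>e\<in>good_seqs m. x ^ length e * (x * (\<Sum>(v, q)\<in>slots e. \<phi> (q - v + 1))))"
  proof (intro sum.cong refl, unfold sum_distrib_left, intro sum.cong refl, clarsimp)
    fix e v q assume s: "(v, q) \<in> slots e"
    then have "q + 1 - v = Suc (q - v)" by (auto simp: slots_def)
    with s show "x ^ length (insert_at (e, v, q)) * \<phi> (slack (insert_at (e, v, q))) =
        x ^ length e * (x * \<phi> (Suc (q - v)))"
      by (simp add: length_insert_at slack_insert_at mult_ac)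
  qed
  also have "sum ?f ?B2 = (\<Sum>p\<in>(SIGMA e:good_seqs m. double_slots e). ?f (insert_twice_at p))"
    by (rule sum.reindex_bij_betw[OF bij_betw_insert_twice_at, symmetric])
  also have "\<dots> = (\<Sum>e\<in>good_seqs m. \<Sum>(v, q, q')\<in>double_slots e. ?f (insert_twice_at (e, v, q, q')))"
    by (subst sum.Sigma) (simp_all add: finite_good_seqs finite_double_slots split_def)
  also have "\<dots> = (\<Sum>e\<in>good_seqs m. x ^ length e * (x\<^sup>2 *
      (\<Sum>(v, q, q')\<in>double_slots e. if q' = q then \<phi> (q - v + 2) else \<phi> (q - v + 1))))"
  proof (intro sum.cong refl, unfold sum_distrib_left, intro sum.cong refl, clarify)
    fix e v q q' assume s: "(v, q, q') \<in> double_slots e"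
    then have "q + 1 - v = q - v + 1" "q + 2 - v = q - v + 2" by (auto simp: double_slots_def)
    with s show "x ^ length (insert_twice_at (e, v, q, q')) * \<phi> (slack (insert_twice_at (e, v, q, q'))) =
        x ^ length e * (x\<^sup>2 * (if q' = q then \<phi> (q - v + 2) else \<phi> (q - v + 1)))"
      by (simp add: length_insert_twice_at slack_insert_twice_at mult_ac power2_eq_square)
  qed
  finally show ?thesis
    unfolding sum_slots[of "\<lambda>d. \<phi> (d + 1)"]
      sum_double_slots[of "\<lambda>d. \<phi> (d + 2)" "\<lambda>d. \<phi> (d + 1)"]
    by (simp add: step_def sum.distrib distrib_left)
qed

text \<open>Levels are peeled off from the deepest one, each changing the weight, which is why the
  induction generalises over \<open>\<phi>\<close>. The final argument 1 is the slack of the empty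
  sequence.\<close>

lemma sum_good_seqs:
  fixes x :: "'a::comm_ring_1"
  shows "(\<Sum>e\<in>good_seqs m. x ^ length e * \<phi> (slack e)) = (step x ^^ m) \<phi> 1"
proof (induction m arbitrary: \<phi>)
  case 0
  have "slack [] = 1" by (simp add: slack_def run_def bound_def)
  then show ?case by (simp add: good_seqs_0)
next
  case (Suc m)
  then show ?case by (simp add: sum_good_seqs_Suc funpow_swap1)
qed

subsection \<open>The kernel equation\<close>

text \<open>This is \<open>G s\<close>: \<open>x\<close> marks inserted entries and \<open>y\<close>
  new distinct values. The constant weight 1 counts continuations whatever their final
  slack.\<close>

definition continuation_ser :: "nat \<Rightarrow> int poly fps" where
  "continuation_ser s = Abs_fps (\<lambda>m. (step [:0, 1:] ^^ m) (\<lambda>_. 1) s)"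

lemma fps_nth_step:
  "step (fps_const c) F s $ m = step c (\<lambda>s. F s $ m) s" for c :: "'a::comm_ring_1"
proof -
  have "(of_nat n :: 'a fps) = fps_const (of_nat n)" for n by (simp add: fps_of_nat)
  then show ?thesis
    by (simp add: step_def fps_sum_nth power2_eq_square mult.assoc)
qed

text \<open>A continuation is empty or starts by inserting one new value, marked by
  \<open>y\<close>, once or twice.\<close>

lemma continuation_ser_eq:
  "continuation_ser s = 1 + ser_y * step ser_x continuation_ser s"
proof (rule fps_ext)
  fix m show "continuation_ser s $ m = (1 + ser_y * step ser_x continuation_ser s) $ m"
    by (cases m) (simp_all add: ser_y_def ser_x_def fps_nth_step, simp_all add: continuation_ser_def)
qed

text \<open>A stand-in for substituting \<open>a\<close> for the outer variable. Comparing
  coefficients gives \<open>H $ k = a * H $ Suc k\<close>, so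
  \<open>c = - (a ^ Suc k * H $ k)\<close> for all \<open>k\<close>; as \<open>a\<close> has no
  constant term, every power of the inner variable divides \<open>c\<close>.\<close>

lemma const_eq_0_if_dvd_linear:
  fixes a c :: "'a::idom fps"
  assumes eq: "(fps_X - fps_const a) * H = fps_const c" and a0: "a $ 0 = 0"
  shows "c = 0"
proof -
  have c: "c = - a * (H $ 0)"
    using arg_cong[OF eq, of "\<lambda>f. f $ 0"] by (simp add: algebra_simps)
  have H: "H $ k = a * H $ Suc k" for k
    using arg_cong[OF eq, of "\<lambda>f. f $ Suc k"] by (simp add: algebra_simps)
  have "H $ 0 = a ^ k * H $ k" for k
    by (induction k) (simp_all add: H[symmetric] mult.assoc power_commutes[symmetric] del: power_Suc,
      metis H mult.assoc power_Suc2)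
  then have "c = - (a ^ Suc k * H $ k)" for k by (simp add: c mult.assoc)
  moreover have "(a ^ Suc j * H $ j) $ j = 0" for j
    using startsby_zero_power_prefix[OF a0, of "Suc j"] by (simp add: fps_mult_nth)
  ultimately have "c $ j = 0" for j by (metis fps_neg_nth neg_equal_0_iff_equal)
  then show ?thesis by (intro fps_ext) simp
qed

text \<open>The sums in \<open>step\<close> are convolutions of \<open>A\<close>, or of its shift
  \<open>(A - J) / v\<close>, with the expansions of \<open>1 / (1 - v)^2\<close> and
  \<open>v / (1 - v)^3\<close>. Multiplying by \<open>v (1 - v)^3\<close> clears denominators; the
  factor of \<open>A\<close> is the kernel.\<close>

lemma continuation_fps_eq:
  fixes A :: "int poly fps fps"
  defines "A \<equiv> Abs_fps (\<lambda>d. continuation_ser (Suc d))"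
    and "X \<equiv> fps_const ser_x" and "Y \<equiv> fps_const ser_y" and "v \<equiv> fps_X"
    and "J \<equiv> fps_const (continuation_ser 1)"
  shows "A * (v * (1 - v) ^ 3 - X * Y * v * (1 - v) - X\<^sup>2 * Y * (1 - v) - X\<^sup>2 * Y * v\<^sup>2) =
    v * (1 - v)\<^sup>2 - X\<^sup>2 * Y * J * (1 - v)"
proof -
  define Q :: "int poly fps fps" where "Q = Abs_fps (\<lambda>_. 1)"
  define T :: "int poly fps fps" where "T = Abs_fps (\<lambda>k. of_nat (Suc k))"
  define C :: "int poly fps fps" where "C = Abs_fps (\<lambda>k. of_nat (Suc k choose 2))"
  define A' where "A' = fps_shift 1 A"
  have Q: "(1 - v) * Q = 1"
  proof (rule fps_ext)
    fix n show "((1 - v) * Q) $ n = 1 $ n"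
      by (cases n) (simp_all add: left_diff_distrib v_def Q_def)
  qed
  have T: "(1 - v) * T = Q"
  proof (rule fps_ext)
    fix n show "((1 - v) * T) $ n = Q $ n"
      by (cases n) (simp_all add: left_diff_distrib v_def Q_def T_def)
  qed
  have C: "(1 - v) * C = v * T"
  proof (rule fps_ext)
    fix n show "((1 - v) * C) $ n = (v * T) $ n"
      by (cases n) (simp_all add: left_diff_distrib v_def C_def T_def numeral_2_eq_2)
  qed
  have A': "v * A' = A - J"
  proof (rule fps_ext)
    fix n show "(v * A') $ n = (A - J) $ n"
      by (cases n) (simp_all add: v_def A'_def A_def J_def)
  qed
  have "A = Q + Y * (X * (A * T) + X\<^sup>2 * (A' * T + A * C))"
  proof (rule fps_ext)
    fix k
    \<comment> \<open>Coefficient \<open>k\<close> of \<open>A\<close> belongs to slack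
      \<open>k + 1\<close>, hence the range \<open>d < Suc k\<close>. The shift \<open>A'\<close>
      accounts for adjacent copies, which leave one more unit of slack.\<close>
    have conv:
      "(A * T) $ k = (\<Sum>d<Suc k. of_nat (Suc k - d) * continuation_ser (d + 1))"
      "(A' * T) $ k = (\<Sum>d<Suc k. of_nat (Suc k - d) * continuation_ser (d + 2))"
      "(A * C) $ k = (\<Sum>d<Suc k. of_nat ((Suc k - d) choose 2) * continuation_ser (d + 1))"
      unfolding fps_mult_nth lessThan_Suc_atMost atMost_atLeast0
      by (auto intro!: sum.cong simp: A_def A'_def T_def C_def Suc_diff_le mult.commute)
    have "A $ k = 1 + ser_y * step ser_x continuation_ser (Suc k)"
      by (simp add: A_def flip: continuation_ser_eq)
    also have "\<dots> = (Q + Y * (X * (A * T) + X\<^sup>2 * (A' * T + A * C))) $ k"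
      by (simp add: step_def Q_def X_def Y_def power2_eq_square mult.assoc conv)
    finally show "A $ k = (Q + Y * (X * (A * T) + X\<^sup>2 * (A' * T + A * C))) $ k" .
  qed
  then have "v * (1 - v) ^ 3 * A = v * (1 - v) ^ 3 * (Q + Y * (X * (A * T) + X\<^sup>2 * (A' * T + A * C)))"
    by simp
  also have "\<dots> = v * (1 - v)\<^sup>2 * ((1 - v) * Q) + Y * (X * (v * (1 - v) * A * ((1 - v) * ((1 - v) * T)))
      + X\<^sup>2 * ((1 - v) * (v * A') * ((1 - v) * ((1 - v) * T)) + v * A * ((1 - v) * ((1 - v) * ((1 - v) * C)))))"
    by (simp add: algebra_simps power2_eq_square power3_eq_cube)
  also have "\<dots> = v * (1 - v)\<^sup>2 + Y * (X * (v * (1 - v) * A) + X\<^sup>2 * ((1 - v) * (A - J) + v * A * v))"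
  proof -
    have "(1 - v) * ((1 - v) * ((1 - v) * C)) = v * ((1 - v) * ((1 - v) * T))"
      by (simp only: C mult.left_commute)
    then show ?thesis by (simp add: Q T A')
  qed
  finally show ?thesis by (simp add: algebra_simps power2_eq_square)
qed

lemma B_ser_eq:
  "B_ser = 1 + ser_x * ser_y * B_ser\<^sup>2 * (ser_x * B_ser\<^sup>2 - (ser_x - 1) * (B_ser - 1))"
  using B_ser_equation by (simp add: B_equation_def)

lemma B_ser_nth_0: "B_ser $ 0 = 1"
  by (subst B_ser_eq) (simp add: ser_y_def)

lemma B_ser_kernel: "B_ser - 1 = ser_x\<^sup>2 * ser_y * B_ser\<^sup>2 * continuation_ser 1"
proof -
  define B x y J where "B = B_ser" and "x = ser_x" and "y = ser_y" and "J = continuation_ser 1"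
  define I where "I = fps_right_inverse B 1"
  have BI: "B * I = 1" unfolding I_def
    by (rule fps_right_inverse) (simp add: B_def B_ser_nth_0)
  have I0: "I $ 0 = 1" by (simp add: I_def)
  \<comment> \<open>The root \<open>1 - 1/B\<close> of the kernel. It has no constant term in
    \<open>y\<close>, as the lemma on linear factors requires.\<close>
  define V where "V = 1 - I"
  have B_eq: "B = 1 + x * y * B\<^sup>2 * (x * B\<^sup>2 - (x - 1) * (B - 1))"
    unfolding B_def x_def y_def by (rule B_ser_eq)
  \<comment> \<open>Multiplied by \<open>B^4\<close>, this is the equation of
    \<open>B\<close>.\<close>
  have kernel: "V * I ^ 3 - x * y * V * I - x\<^sup>2 * y * I - x\<^sup>2 * y * V\<^sup>2 = 0"
    using B_eq BI unfolding V_def by algebra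
  define A where "A = Abs_fps (\<lambda>d. continuation_ser (Suc d))"
  define X Y v W K where "X = fps_const x" and "Y = fps_const y" and "v = (fps_X :: int poly fps fps)"
    and "W = fps_const V" and "K = fps_const J"
  have eq: "A * (v * (1 - v) ^ 3 - X * Y * v * (1 - v) - X\<^sup>2 * Y * (1 - v) - X\<^sup>2 * Y * v\<^sup>2) =
      v * (1 - v)\<^sup>2 - X\<^sup>2 * Y * K * (1 - v)"
    unfolding A_def X_def Y_def v_def K_def x_def y_def J_def by (rule continuation_fps_eq)
  have root: "W * (1 - W) ^ 3 - X * Y * W * (1 - W) - X\<^sup>2 * Y * (1 - W) - X\<^sup>2 * Y * W\<^sup>2 = 0"
  proof -
    have "1 - W = fps_const I" by (simp add: W_def V_def)
    then have "W * (1 - W) ^ 3 - X * Y * W * (1 - W) - X\<^sup>2 * Y * (1 - W) - X\<^sup>2 * Y * W\<^sup>2 =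
        fps_const (V * I ^ 3 - x * y * V * I - x\<^sup>2 * y * I - x\<^sup>2 * y * V\<^sup>2)"
      by (simp only: W_def X_def Y_def fps_const_mult fps_const_power fps_const_sub)
    then show ?thesis by (simp only: kernel fps_const_0_eq_0)
  qed
  \<comment> \<open>\<open>A\<close> times the divided difference of the kernel between
    \<open>v\<close> and \<open>W\<close>, minus that of the right-hand side. As the kernel vanishes
    at \<open>W\<close>, multiplying by \<open>v - W\<close> leaves the right-hand side at
    \<open>W\<close>, which is free of \<open>v\<close>.\<close>
  define H where "H = A * (1 - 3 * (v + W) + 3 * (v\<^sup>2 + v * W + W\<^sup>2) - (v ^ 3 + v\<^sup>2 * W + v * W\<^sup>2 + W ^ 3)
      - X * Y * (1 - (v + W)) + X\<^sup>2 * Y - X\<^sup>2 * Y * (v + W))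
      - (1 - 2 * (v + W) + (v\<^sup>2 + v * W + W\<^sup>2) + X\<^sup>2 * Y * K)"
  have "(v - W) * H = W * (1 - W)\<^sup>2 - X\<^sup>2 * Y * K * (1 - W)"
    using eq root unfolding H_def by algebra
  also have "\<dots> = fps_const (V * I\<^sup>2 - x\<^sup>2 * y * J * I)"
  proof -
    have "1 - W = fps_const I" by (simp add: W_def V_def)
    then show ?thesis
      by (simp only: W_def X_def Y_def K_def fps_const_mult fps_const_power fps_const_sub)
  qed
  finally have "V * I\<^sup>2 - x\<^sup>2 * y * J * I = 0"
    unfolding v_def W_def by (rule const_eq_0_if_dvd_linear) (simp add: V_def I0)
  then have "B - 1 = x\<^sup>2 * y * B\<^sup>2 * J"
    using BI unfolding V_def by algebra
  then show ?thesis by (simp add: B_def x_def y_def J_def)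
qed

section \<open>Extracting the coefficients\<close>

text \<open>The kernel identity and the equation of \<open>B\<close> both write \<open>B - 1\<close>
  as a multiple of \<open>x y B^2\<close>; cancelling this nonzero factor equates the
  cofactors.\<close>

lemma ser_x_mult_continuation_ser:
  "ser_x * continuation_ser 1 = ser_x + (B_ser - 1) * (1 + ser_x * B_ser)"
proof -
  define c where "c = ser_x * ser_y * B_ser\<^sup>2"
  have "c * (ser_x * continuation_ser 1) = B_ser - 1"
    by (simp add: B_ser_kernel c_def power2_eq_square mult_ac)
  also have "\<dots> = c * (ser_x + (B_ser - 1) * (1 + ser_x * B_ser))"
    by (subst B_ser_eq) (simp add: c_def algebra_simps power2_eq_square)
  finally have "c * (ser_x * continuation_ser 1) = c * (ser_x + (B_ser - 1) * (1 + ser_x * B_ser))" .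
  moreover have "c \<noteq> 0"
  proof -
    have "B_ser \<noteq> 0" using B_ser_nth_0 by auto
    then show ?thesis by (simp add: c_def ser_x_def ser_y_def)
  qed
  ultimately show ?thesis by simp
qed

text \<open>By the kernel identity \<open>x\<close> divides \<open>B - 1\<close>. This is why the
  sum over \<open>k\<close> in the theorem starts at 1.\<close>

lemma coeff_B_ser_minus_1: "coeff ((B_ser - 1) $ l) k = (if k = 0 then 0 else b_coeff k l)"
proof (cases "k = 0")
  case True
  have "B_ser - 1 = ser_x * (ser_x * ser_y * B_ser\<^sup>2 * continuation_ser 1)"
    by (subst B_ser_kernel) (simp add: power2_eq_square mult_ac)
  then show ?thesis using True by (simp add: ser_x_def)
next
  case False
  then show ?thesis by (simp add: b_coeff_def coeff_eq_0)
qed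

lemma coeff_continuation_ser:
  assumes "m \<ge> 1"
  shows "coeff (continuation_ser 1 $ m) n =
    b_coeff (n + 1) m + (\<Sum>k=1..n. \<Sum>l=0..m. b_coeff k l * b_coeff (n - k) (m - l))"
proof -
  have x: "coeff ((ser_x * F) $ m) (Suc n) = coeff (F $ m) n" for F
    by (simp add: ser_x_def)
  have "coeff (continuation_ser 1 $ m) n = coeff ((ser_x * continuation_ser 1) $ m) (Suc n)"
    by (simp add: x)
  also have "ser_x * continuation_ser 1 = ser_x + (B_ser - 1) + ser_x * ((B_ser - 1) * B_ser)"
    by (subst ser_x_mult_continuation_ser) (simp add: algebra_simps)
  \<comment> \<open>The lone summand \<open>x\<close> is free of \<open>y\<close>, so
    \<open>m \<ge> 1\<close> removes it.\<close>
  also have "coeff (\<dots> $ m) (Suc n) = b_coeff (n + 1) m + coeff (((B_ser - 1) * B_ser) $ m) n"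
    using assms x[of "(B_ser - 1) * B_ser"] coeff_B_ser_minus_1[of m "Suc n"]
    by (simp add: ser_x_def)
  also have "coeff (((B_ser - 1) * B_ser) $ m) n =
      (\<Sum>l=0..m. \<Sum>k\<le>n. coeff ((B_ser - 1) $ l) k * b_coeff (n - k) (m - l))"
    by (simp only: fps_mult_nth coeff_sum coeff_mult b_coeff_def)
  also have "\<dots> = (\<Sum>l=0..m. \<Sum>k=1..n. b_coeff k l * b_coeff (n - k) (m - l))"
    by (intro sum.cong refl sum.mono_neutral_cong_right)
       (auto simp: coeff_B_ser_minus_1 simp del: fps_sub_nth)
  also have "\<dots> = (\<Sum>k=1..n. \<Sum>l=0..m. b_coeff k l * b_coeff (n - k) (m - l))"
    by (rule sum.swap)
  finally show ?thesis .
qed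

text \<open>With constant weight 1 the sum over the tree records only lengths, as exponents of
  \<open>x\<close>.\<close>

lemma continuation_ser_counts:
  "coeff (continuation_ser 1 $ m) n = int (card {e \<in> good_seqs m. length e = n})"
proof -
  have "continuation_ser 1 $ m = (\<Sum>e\<in>good_seqs m. [:0, 1:] ^ length e)"
    using sum_good_seqs[of "[:0, 1:] :: int poly" "\<lambda>_. 1" m] by (simp add: continuation_ser_def)
  also have "\<dots> = (\<Sum>e\<in>good_seqs m. monom 1 (length e))"
    by (simp add: monom_altdef)
  finally show ?thesis
    by (simp add: coeff_sum finite_good_seqs sum.If_cases Int_def)
qed

theorem theorem4p1:
  fixes n m :: nat
  assumes "n \<ge> 1" and "m \<ge> 1"
  shows "int (card {e \<in> inversion_seqs n. avoids_102 e \<and> avoids_000 e \<and> num_distinct e = m})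
       = b_coeff (n + 1) m + (\<Sum>k=1..n. \<Sum>l=0..m. b_coeff k l * b_coeff (n - k) (m - l))"
proof -
  have "{e \<in> inversion_seqs n. avoids_102 e \<and> avoids_000 e \<and> num_distinct e = m} =
      {e \<in> good_seqs m. length e = n}"
    by (auto simp: inversion_seqs_iff good_seqs_def good_def num_distinct_def)
  with assms show ?thesis
    by (simp only: flip: continuation_ser_counts) (rule coeff_continuation_ser)
qed

end
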